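(* For all integers $n\ge k\ge 0$, $$\sum_{j=0}^{n-k}\binom{n}{k}k^{j}x^{j}H_{\lambda}^{Y}(n-k,j)= B_{n,k}\Big(H_{0,\lambda}^{Y}(x),2H_{1,\lambda}^{Y}(x),3H_{2,\lambda}^{Y}(x),\dots,(n-k+1)H_{n-k,\lambda}^{Y}(x)\Big),$$ with the convention $0^0=1$.
   Context: Let $Y$ be a real random variable with $E[|Y|^{n}]<\infty$ for all integers $n\ge 0$ and $\lim_{n\to\infty}|t|^{n}E[|Y|^{n}]/n!=0$ for $|t|<r$, for some $r>0$. Fix a nonzero real $\lambda$. Put $\langle x\rangle_{0,\lambda}=1$, $\langle x\rangle_{n,\lambda}=x(x+\lambda)\cdots(x+(n-1)\lambda)$, and $e_\lambda^{-Y}(-t)=(1-\lambda t)^{-Y/\lambda}$, so $E[e_\lambda^{-Y}(-t)]=\sum_{n\ge0}E[\langle Y\rangle_{n,\lambda}]t^n/n!$ near $t=0$. The probabilistic heterogeneous Stirling numbers of the second kind are defined by $\frac{1}{k!}(E[e_{\lambda}^{-Y}(-t)]-1)^{k}=\sum_{n\ge k}H_{\lambda}^{Y}(n,k)t^{n}/n!$, and the probabilistic heterogeneous Bell polynomials by $e^{x(E[e_{\lambda}^{-Y}(-t)]-1)}=\sum_{n\ge0}H_{n,\lambda}^{Y}(x)t^{n}/n!$. The partial Bell polynomials $B_{n,k}$ are defined by $\frac{1}{k!}\big(\sum_{m\ge1}x_{m}\frac{t^{m}}{m!}\big)^{k}=\sum_{n\ge k}B_{n,k}(x_{1},\dots,x_{n-k+1})\frac{t^{n}}{n!}$.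 *)

theory Defs
  imports "HOL-Probability.Probability"
begin

text \<open>
  Coefficients of an exponential generating function: \<open>egf_coeff f n\<close> is \<open>a\<^sub>n\<close> in
  \<open>f t = (\<Sum>n. a\<^sub>n * t ^ n / n!)\<close>, valid in a neighbourhood of \<open>t = 0\<close>.
  The power series is unique when it exists; see \<open>egf_coeff_eq\<close>.
\<close>

definition egf_coeff :: "(real \<Rightarrow> real) \<Rightarrow> nat \<Rightarrow> real" where
  "egf_coeff f n = fact n * fps_nth (THE F. f has_fps_expansion F) n"

lemma has_fps_expansion_real_unique:
  fixes F G :: "real fps"
  assumes "f has_fps_expansion F" "f has_fps_expansion G"
  shows "F = G"
proof (rule fps_ext)
  show "fps_nth F n = fps_nth G n" for n
    using assms
  proof (induction n arbitrary: f F G)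
    case 0
    then show ?case
      by (auto simp: has_fps_expansion_def eval_fps_at_0 dest!: eventually_nhds_x_imp_x)
  next
    case (Suc n)
    have "fps_nth (fps_deriv F) n = fps_nth (fps_deriv G) n"
      using Suc.prems by (intro Suc.IH[of "deriv f"] has_fps_expansion_deriv)
    then show ?case
      by (simp del: of_nat_Suc)
  qed
qed

lemma egf_coeff_eq:
  assumes "f has_fps_expansion F"
  shows "egf_coeff f n = fact n * fps_nth F n"
proof -
  have "(THE F. f has_fps_expansion F) = F"
    using assms has_fps_expansion_real_unique by blast
  then show ?thesis
    by (simp add: egf_coeff_def)
qed

text \<open>
  The degenerate exponential \<open>e\<^sub>\<lambda>\<^sup>x(t) = (1 + \<lambda> t)\<^bsup>x/\<lambda>\<^esup>\<close>; it is only meaningful for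
  \<open>1 + \<lambda> t > 0\<close>, which holds near \<open>t = 0\<close>.
\<close>

definition deg_exp :: "real \<Rightarrow> real \<Rightarrow> real \<Rightarrow> real" where
  "deg_exp l x t = (1 + l * t) powr (x / l)"

definition het_gf :: "'a measure \<Rightarrow> ('a \<Rightarrow> real) \<Rightarrow> real \<Rightarrow> real \<Rightarrow> real" where
  "het_gf M Y l t = integral\<^sup>L M (\<lambda>\<omega>. deg_exp l (- Y \<omega>) (- t))"

text \<open>
  Since \<open>het_gf M Y l 0 = 1\<close>, the coefficients with \<open>n < k\<close> of the following generating
  function vanish, so the expansion is effectively indexed by \<open>n \<ge> k\<close>.
\<close>

definition het_stirling :: "'a measure \<Rightarrow> ('a \<Rightarrow> real) \<Rightarrow> real \<Rightarrow> nat \<Rightarrow> nat \<Rightarrow> real" where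
  "het_stirling M Y l n k = egf_coeff (\<lambda>t. 1 / fact k * (het_gf M Y l t - 1) ^ k) n"

definition het_bell :: "'a measure \<Rightarrow> ('a \<Rightarrow> real) \<Rightarrow> real \<Rightarrow> nat \<Rightarrow> real \<Rightarrow> real" where
  "het_bell M Y l n x = egf_coeff (\<lambda>t. exp (x * (het_gf M Y l t - 1))) n"

text \<open>
  The value \<open>B\<^sub>n\<^sub>,\<^sub>k(x\<^sub>1, x\<^sub>2, \<dots>)\<close> of the partial Bell polynomial, defined by its formal
  exponential generating function. The arguments are given as a sequence \<open>x\<close> whose
  entry \<open>x 0\<close> is ignored; only \<open>x 1, \<dots>, x (n - k + 1)\<close> matter (\<open>partial_bell_cong\<close>).
\<close>

definition partial_bell :: "nat \<Rightarrow> nat \<Rightarrow> (nat \<Rightarrow> 'a :: field_char_0) \<Rightarrow> 'a" where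
  "partial_bell n k x = fact n *
     fps_nth (fps_const (1 / fact k) * Abs_fps (\<lambda>m. if m = 0 then 0 else x m / fact m) ^ k) n"

lemma partial_bell_cong:
  assumes "k \<le> n" and eq: "\<And>m. 1 \<le> m \<Longrightarrow> m \<le> n - k + 1 \<Longrightarrow> x m = y m"
  shows "partial_bell n k x = partial_bell n k y"
proof -
  define S where "S z = Abs_fps (\<lambda>m. z (Suc m) / fact (Suc m))" for z :: "nat \<Rightarrow> 'a"
  have shift: "Abs_fps (\<lambda>m. if m = 0 then 0 else z m / fact m) = fps_X * S z" for z :: "nat \<Rightarrow> 'a"
    by (rule fps_ext) (auto simp: S_def fact_reduce)
  have pow: "fps_nth (S x ^ j) i = fps_nth (S y ^ j) i" if "i \<le> n - k" for i j
    using that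
  proof (induction j arbitrary: i)
    case (Suc j)
    have "fps_nth (S x) a = fps_nth (S y) a" if "a \<le> i" for a
      using eq[of "Suc a"] that Suc.prems by (simp add: S_def)
    then show ?case
      using Suc.IH Suc.prems by (auto simp: fps_mult_nth intro!: sum.cong)
  qed simp
  show ?thesis
    using assms(1) pow[of "n - k" k]
    by (simp add: partial_bell_def shift power_mult_distrib fps_X_power_mult_nth)
qed

end

theory Submission
  imports Defs "HOL-Complex_Analysis.Laurent_Convergence"
begin

text \<open>
  Writing \<open>s = - ln (1 - \<lambda>t) / \<lambda>\<close>, the generating function \<open>E[e\<^sub>\<lambda>\<^sup>-\<^sup>Y(-t)]\<close> is the moment
  generating function of \<open>Y\<close> at \<open>s\<close>. The growth condition on the moments makes the latter
  analytic near \<open>0\<close>, so the former has a power series expansion \<open>G\<close> with constant term \<open>1\<close>.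
  The identity then compares coefficients of \<open>t\<^sup>n\<close> in
  \<open>(t exp (x (G - 1)))\<^sup>k / k! = t\<^sup>k / k! * (\<Sum>j. (k x)\<^sup>j (G - 1)\<^sup>j / j!)\<close>.
\<close>

section \<open>Composition of real power series expansions\<close>

definition complex_fps :: "real fps \<Rightarrow> complex fps" where
  "complex_fps F = Abs_fps (\<lambda>n. complex_of_real (fps_nth F n))"

lemma complex_fps_nth [simp]: "fps_nth (complex_fps F) n = complex_of_real (fps_nth F n)"
  by (simp add: complex_fps_def)

lemma complex_fps_mult: "complex_fps (F * G) = complex_fps F * complex_fps G"
  by (rule fps_ext) (simp add: fps_mult_nth)

lemma complex_fps_power: "complex_fps (F ^ n) = complex_fps F ^ n"
proof (induction n)
  case 0
  show ?case by (rule fps_ext) simp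
qed (simp add: complex_fps_mult)

lemma complex_fps_compose: "complex_fps (F oo G) = complex_fps F oo complex_fps G"
  by (rule fps_ext) (simp add: fps_compose_nth flip: complex_fps_power)

lemma fps_conv_radius_complex_fps [simp]:
  "fps_conv_radius (complex_fps F) = fps_conv_radius F"
  by (simp add: fps_conv_radius_def conv_radius_def)

lemma eval_complex_fps_of_real:
  assumes "ereal \<bar>x\<bar> < fps_conv_radius F"
  shows "eval_fps (complex_fps F) (complex_of_real x) = complex_of_real (eval_fps F x)"
proof -
  have "summable (\<lambda>n. fps_nth F n * x ^ n)"
    using assms by (intro summable_fps) simp
  then show ?thesis
    unfolding eval_fps_def by (subst suminf_of_real) auto
qed

lemma eventually_nhds_0_abs_less_ereal:
  assumes "R > 0"
  shows "eventually (\<lambda>x::real. ereal \<bar>x\<bar> < R) (nhds 0)"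
proof -
  have "eventually (\<lambda>x::real. x \<in> eball 0 R) (nhds 0)"
    using assms by (intro eventually_nhds_in_open) (auto simp: zero_ereal_def)
  then show ?thesis
    by (simp add: eball_def)
qed

text \<open>Extending both series to the complex plane reduces this to composition of analytic functions.\<close>

lemma has_fps_expansion_compose_real:
  fixes f g :: "real \<Rightarrow> real"
  assumes F: "f has_fps_expansion F" and G: "g has_fps_expansion G" and G0: "fps_nth G 0 = 0"
  shows "(\<lambda>x. f (g x)) has_fps_expansion (F oo G)"
proof -
  have rad: "fps_conv_radius F > 0" "fps_conv_radius G > 0"
    using F G by (auto simp: has_fps_expansion_def)
  have "(eval_fps (complex_fps F) \<circ> eval_fps (complex_fps G)) has_fps_expansion
          (complex_fps F oo complex_fps G)"
    using rad G0
    by (intro has_fps_expansion_compose eval_fps_has_fps_expansion) auto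
  then have C: "(eval_fps (complex_fps F) \<circ> eval_fps (complex_fps G)) has_fps_expansion
                  complex_fps (F oo G)"
    by (simp add: complex_fps_compose)
  \<comment> \<open>The embedding preserves norms of coefficients, so the positive radius of the
    complex composite is also that of \<open>F oo G\<close>.\<close>
  have radFG: "fps_conv_radius (F oo G) > 0"
    using C by (auto simp: has_fps_expansion_def)
  have "filterlim complex_of_real (nhds 0) (nhds 0)"
    using tendsto_of_real[OF filterlim_ident[of "nhds (0::real)"], where 'a = complex] by simp
  moreover have "eventually (\<lambda>z. eval_fps (complex_fps (F oo G)) z =
      eval_fps (complex_fps F) (eval_fps (complex_fps G) z)) (nhds 0)"
    using C by (simp add: has_fps_expansion_def)
  \<comment> \<open>The complex identity is restricted to the real axis along the embedding, which
    is continuous at 0.\<close>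
  ultimately have ev1: "eventually (\<lambda>x. eval_fps (complex_fps (F oo G)) (complex_of_real x) =
      eval_fps (complex_fps F) (eval_fps (complex_fps G) (complex_of_real x))) (nhds 0)"
    by (rule eventually_compose_filterlim[rotated])
  have ev2: "eventually (\<lambda>x. eval_fps G x = g x) (nhds 0)"
    using G by (simp add: has_fps_expansion_def)
  have "g 0 = 0"
    using eventually_nhds_x_imp_x[OF ev2] G0 by (simp add: eval_fps_at_0)
  moreover have "isCont g 0"
    using has_fps_expansion_imp_continuous[OF G] by simp
  ultimately have "filterlim g (nhds 0) (nhds 0)"
    by (metis isCont_def tendsto_at_iff_tendsto_nhds)
  \<comment> \<open>The bound on \<open>y\<close> is carried along because the value of
    \<open>complex_fps F\<close> at \<open>g x\<close> is known to be real only when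
    \<open>g x\<close> lies inside the radius of \<open>F\<close>.\<close>
  moreover have "eventually (\<lambda>y. eval_fps F y = f y \<and> ereal \<bar>y\<bar> < fps_conv_radius F) (nhds 0)"
    using F eventually_nhds_0_abs_less_ereal[OF rad(1)]
    by (auto simp: has_fps_expansion_def eventually_conj_iff)
  ultimately have ev3:
    "eventually (\<lambda>x. eval_fps F (g x) = f (g x) \<and> ereal \<bar>g x\<bar> < fps_conv_radius F) (nhds 0)"
    by (rule eventually_compose_filterlim[rotated])
  have "eventually (\<lambda>x. eval_fps (F oo G) x = f (g x)) (nhds 0)"
    using ev1 ev2 ev3 eventually_nhds_0_abs_less_ereal[OF rad(2)]
      eventually_nhds_0_abs_less_ereal[OF radFG]
  proof eventually_elim
    case (elim x)
    then have "complex_of_real (eval_fps (F oo G) x) = complex_of_real (f (g x))"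
      by (simp add: eval_complex_fps_of_real)
    then show ?case
      by (simp only: of_real_eq_iff)
  qed
  with radFG show ?thesis
    by (simp add: has_fps_expansion_def)
qed

section \<open>The generating function of the heterogeneous numbers\<close>

lemma has_fps_expansion_ln_1_plus: "(\<lambda>x::real. ln (1 + x)) has_fps_expansion fps_ln 1"
proof (rule has_fps_expansionI)
  have "eventually (\<lambda>u::real. \<bar>u\<bar> < 1) (nhds 0)"
    using eventually_nhds_0_abs_less_ereal[of 1] by (simp add: one_ereal_def)
  then show "eventually (\<lambda>u::real. (\<lambda>n. fps_nth (fps_ln 1) n * u ^ n) sums ln (1 + u)) (nhds 0)"
  proof eventually_elim
    case (elim u)
    \<comment> \<open>At \<open>n = 0\<close> the left side divides by zero and is therefore 0,
      which agrees with the vanishing constant term of \<open>fps_ln 1\<close>.\<close>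
    have "- ((- u) ^ n) / real n = fps_nth (fps_ln 1) n * u ^ n" for n
      by (cases n) (simp_all add: fps_ln_nth power_minus[of u])
    then show ?case
      using ln_series'[OF elim] by simp
  qed
qed

text \<open>The exponential series is integrated term by term. This is justified by the absolute
  moments: a null sequence is bounded, so the growth condition gives a geometric majorant for
  \<open>E m * \<bar>s\<bar> ^ m\<close> at every \<open>s\<close> with absolute value below
  \<open>r\<close>.\<close>

lemma has_fps_expansion_mgf:
  fixes Y :: "'a \<Rightarrow> real"
  assumes Y: "Y \<in> borel_measurable M"
    and int: "\<And>m::nat. integrable M (\<lambda>\<omega>. \<bar>Y \<omega>\<bar> ^ m)"
    and "r > 0"
    and lim: "\<And>t::real. \<bar>t\<bar> < r \<Longrightarrow>
           (\<lambda>m. \<bar>t\<bar> ^ m * integral\<^sup>L M (\<lambda>\<omega>. \<bar>Y \<omega>\<bar> ^ m) / fact m) \<longlonglongrightarrow> 0"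
  shows "(\<lambda>s. integral\<^sup>L M (\<lambda>\<omega>. exp (s * Y \<omega>))) has_fps_expansion
           Abs_fps (\<lambda>m. integral\<^sup>L M (\<lambda>\<omega>. Y \<omega> ^ m) / fact m)"
proof (rule has_fps_expansionI)
  define E where "E m = integral\<^sup>L M (\<lambda>\<omega>. \<bar>Y \<omega>\<bar> ^ m) / fact m" for m
  have "eventually (\<lambda>u::real. \<bar>u\<bar> < r) (nhds 0)"
    using eventually_nhds_0_abs_less_ereal[of r] \<open>r > 0\<close> by simp
  then show "eventually (\<lambda>u. (\<lambda>n. fps_nth (Abs_fps (\<lambda>m. integral\<^sup>L M (\<lambda>\<omega>. Y \<omega> ^ m) / fact m)) n * u ^ n)
      sums integral\<^sup>L M (\<lambda>\<omega>. exp (u * Y \<omega>))) (nhds 0)"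
  proof eventually_elim
    case (elim s)
    \<comment> \<open>The room between \<open>\<bar>s\<bar>\<close> and \<open>r\<close> is what
      makes the ratio \<open>\<bar>s\<bar> / u\<close> of the geometric majorant smaller than
      1.\<close>
    then obtain u where u: "\<bar>s\<bar> < u" "u < r"
      using dense by blast
    have "(\<lambda>m. E m * u ^ m) \<longlonglongrightarrow> 0"
      using lim[of u] u by (simp add: E_def mult.commute)
    then have "Bseq (\<lambda>m. E m * u ^ m)"
      using convergent_imp_Bseq convergent_def by blast
    then obtain B where B: "\<And>m. norm (E m * u ^ m) \<le> B"
      by (auto simp: Bseq_def)
    have summ: "summable (\<lambda>m. E m * \<bar>s\<bar> ^ m)"
    proof (rule summable_comparison_test')
      show "summable (\<lambda>m. B * (\<bar>s\<bar> / u) ^ m)"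
        using u by (intro summable_mult summable_geometric) auto
      show "norm (E m * \<bar>s\<bar> ^ m) \<le> B * (\<bar>s\<bar> / u) ^ m" for m
      proof -
        have "norm (E m * \<bar>s\<bar> ^ m) = norm (E m * u ^ m) * (\<bar>s\<bar> / u) ^ m"
          using u by (cases "u = 0") (auto simp: abs_mult power_divide power_abs)
        also have "\<dots> \<le> B * (\<bar>s\<bar> / u) ^ m"
          using u B[of m] by (intro mult_right_mono) auto
        finally show ?thesis .
      qed
    qed
    define f where "f m \<omega> = (s * Y \<omega>) ^ m / fact m" for m \<omega>
    have norm_f: "norm (f m \<omega>) = \<bar>s\<bar> ^ m / fact m * \<bar>Y \<omega>\<bar> ^ m" for m \<omega>
      by (simp add: f_def power_abs abs_mult power_mult_distrib)
    have intY: "integrable M (\<lambda>\<omega>. Y \<omega> ^ m)" for m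
      using int[of m] Y by (subst integrable_norm_iff[symmetric]) (auto simp: power_abs)
    \<comment> \<open>Pointwise absolute summability comes from the exponential series, and the sum
      of the integrated norms is exactly the series \<open>summ\<close>.\<close>
    have "(\<lambda>m. integral\<^sup>L M (f m)) sums (\<integral>\<omega>. (\<Sum>m. f m \<omega>) \<partial>M)"
    proof (rule sums_integral)
      show "integrable M (f m)" for m
        unfolding f_def power_mult_distrib using intY[of m] by simp
      show "AE \<omega> in M. summable (\<lambda>m. norm (f m \<omega>))"
      proof (rule AE_I2)
        fix \<omega>
        show "summable (\<lambda>m. norm (f m \<omega>))"
          using summable_norm_exp[of "s * Y \<omega>"] by (simp add: f_def divide_inverse mult.commute)
      qed
      show "summable (\<lambda>m. integral\<^sup>L M (\<lambda>\<omega>. norm (f m \<omega>)))"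
        unfolding norm_f using summ by (simp add: E_def mult.commute)
    qed
    moreover have "(\<Sum>m. f m \<omega>) = exp (s * Y \<omega>)" for \<omega>
      by (simp add: f_def exp_def divide_inverse mult.commute)
    moreover have "integral\<^sup>L M (f m) = integral\<^sup>L M (\<lambda>\<omega>. Y \<omega> ^ m) / fact m * s ^ m" for m
      by (simp add: f_def[abs_def] power_mult_distrib)
    ultimately show ?case
      by simp
  qed
qed

lemma het_gf_has_fps_expansion:
  fixes M :: "'a measure" and Y :: "'a \<Rightarrow> real" and l r :: real
  assumes "prob_space M"
    and "Y \<in> borel_measurable M"
    and "\<And>m::nat. integrable M (\<lambda>\<omega>. \<bar>Y \<omega>\<bar> ^ m)"
    and "r > 0"
    and "\<And>t::real. \<bar>t\<bar> < r \<Longrightarrow>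
           (\<lambda>m. \<bar>t\<bar> ^ m * integral\<^sup>L M (\<lambda>\<omega>. \<bar>Y \<omega>\<bar> ^ m) / fact m) \<longlonglongrightarrow> 0"
    and "l \<noteq> 0"
  obtains G where "het_gf M Y l has_fps_expansion G" "fps_nth G 0 = 1"
proof -
  interpret prob_space M by fact
  let ?mgf = "\<lambda>s. integral\<^sup>L M (\<lambda>\<omega>. exp (s * Y \<omega>))"
  define A where "A = Abs_fps (\<lambda>m. integral\<^sup>L M (\<lambda>\<omega>. Y \<omega> ^ m) / fact m)"
  define L :: "real fps" where "L = fps_ln 1 oo (fps_const (-l) * fps_X)"
  define S where "S = fps_const (-1 / l) * L"
  have "(\<lambda>t. ln (1 + (-l) * t)) has_fps_expansion L"
    unfolding L_def
    by (intro has_fps_expansion_compose_real[OF has_fps_expansion_ln_1_plus]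
          has_fps_expansion_cmult_left has_fps_expansion_fps_X) simp
  then have S: "(\<lambda>t. -1 / l * ln (1 + (-l) * t)) has_fps_expansion S"
    unfolding S_def by (rule has_fps_expansion_cmult_left)
  have "?mgf has_fps_expansion A"
    unfolding A_def using assms by (intro has_fps_expansion_mgf) auto
  from has_fps_expansion_compose_real[OF this S]
  have *: "(\<lambda>t. ?mgf (-1 / l * ln (1 + (-l) * t))) has_fps_expansion (A oo S)"
    by (simp add: S_def L_def)
  \<comment> \<open>The bound keeps \<open>1 - l * t\<close> positive, so that \<open>powr\<close>
    unfolds to the exponential of a multiple of the logarithm.\<close>
  have "eventually (\<lambda>t::real. \<bar>t\<bar> < 1 / \<bar>l\<bar>) (nhds 0)"
    using eventually_nhds_0_abs_less_ereal[of "ereal (1 / \<bar>l\<bar>)"] \<open>l \<noteq> 0\<close> by simp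
  then have "eventually (\<lambda>t. ?mgf (-1 / l * ln (1 + (-l) * t)) = het_gf M Y l t) (nhds 0)"
  proof eventually_elim
    case (elim t)
    then have "\<bar>l * t\<bar> < 1"
      using \<open>l \<noteq> 0\<close> by (simp add: abs_mult field_simps)
    then have "1 - l * t > 0"
      by linarith
    then show ?case
      by (simp add: het_gf_def deg_exp_def powr_def mult_ac)
  qed
  from iffD1[OF has_fps_expansion_cong[OF this refl] *]
  have "het_gf M Y l has_fps_expansion (A oo S)" .
  \<comment> \<open>Only the constant term of \<open>A\<close> survives: it is the zeroth moment,
    the total mass of the probability measure.\<close>
  moreover have "fps_nth (A oo S) 0 = 1"
    by (simp add: A_def prob_space)
  ultimately show thesis
    by (rule that)
qed

theorem theorem2p12:
  fixes M :: "'a measure" and Y :: "'a \<Rightarrow> real" and l r x :: real and n k :: nat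
  assumes "prob_space M"
    and "Y \<in> borel_measurable M"
    and "\<And>m::nat. integrable M (\<lambda>\<omega>. \<bar>Y \<omega>\<bar> ^ m)"
    and "r > 0"
    and "\<And>t::real. \<bar>t\<bar> < r \<Longrightarrow>
           (\<lambda>m. \<bar>t\<bar> ^ m * integral\<^sup>L M (\<lambda>\<omega>. \<bar>Y \<omega>\<bar> ^ m) / fact m) \<longlonglongrightarrow> 0"
    and "l \<noteq> 0"
    and "k \<le> n"
  shows "(\<Sum>j = 0..n - k. real (n choose k) * real k ^ j * x ^ j * het_stirling M Y l (n - k) j)
       = partial_bell n k (\<lambda>m. real m * het_bell M Y l (m - 1) x)"
proof -
  obtain G where G: "het_gf M Y l has_fps_expansion G" and G0: "fps_nth G 0 = 1"
    using het_gf_has_fps_expansion[OF assms(1-6)] by blast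
  \<comment> \<open>Subtracting the constant term makes \<open>H\<close> start at order at least 1,
    so substituting \<open>H\<close> into the exponential series is legitimate.\<close>
  define H where "H = G - 1"
  have H: "(\<lambda>t. het_gf M Y l t - 1) has_fps_expansion H" and H0: "fps_nth H 0 = 0"
    unfolding H_def by (intro has_fps_expansion_diff has_fps_expansion_1 G) (simp add: G0)
  have stirling: "het_stirling M Y l m j = fact m / fact j * fps_nth (H ^ j) m" for m j
  proof -
    have "(\<lambda>t. 1 / fact j * (het_gf M Y l t - 1) ^ j) has_fps_expansion
            fps_const (1 / fact j) * H ^ j"
      by (intro has_fps_expansion_cmult_left has_fps_expansion_power H)
    then show ?thesis
      by (simp add: het_stirling_def egf_coeff_eq)
  qed
  have bell: "het_bell M Y l m x = fact m * fps_nth (fps_exp x oo H) m" for m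
    using has_fps_expansion_compose_real[OF has_fps_expansion_exp H H0]
    by (simp add: het_bell_def egf_coeff_eq)
  \<comment> \<open>The factor \<open>m\<close> turns \<open>1 / m!\<close> into
    \<open>1 / (m - 1)!\<close>, so the arguments of the Bell polynomial form the Bell generating
    series shifted by one power of \<open>t\<close>.\<close>
  have arg: "Abs_fps (\<lambda>m. if m = 0 then 0 else real m * het_bell M Y l (m - 1) x / fact m)
      = fps_X * (fps_exp x oo H)"
  proof (rule fps_ext)
    fix m
    show "fps_nth (Abs_fps (\<lambda>m. if m = 0 then 0 else real m * het_bell M Y l (m - 1) x / fact m)) m
        = fps_nth (fps_X * (fps_exp x oo H)) m"
      by (cases m) (simp_all add: bell field_simps del: of_nat_Suc)
  qed
  have "(fps_exp x oo H) ^ k = fps_exp (real k * x) oo H"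
    by (simp add: fps_compose_power[OF H0] fps_exp_power_mult)
  \<comment> \<open>The factor \<open>fps_X ^ k\<close> moves the coefficient from index
    \<open>n\<close> to \<open>n - k\<close>.\<close>
  then have "partial_bell n k (\<lambda>m. real m * het_bell M Y l (m - 1) x)
      = fact n / fact k * fps_nth (fps_exp (real k * x) oo H) (n - k)"
    using \<open>k \<le> n\<close>
    unfolding partial_bell_def arg by (simp add: power_mult_distrib fps_X_power_mult_nth)
  \<comment> \<open>The sum over \<open>j\<close> stops at \<open>n - k\<close> because
    \<open>H ^ j\<close> has no terms of order below \<open>j\<close>. For \<open>k = 0\<close> only
    \<open>j = 0\<close> contributes, with \<open>0 ^ 0 = 1\<close>.\<close>
  also have "\<dots> = (\<Sum>j = 0..n - k.
      fact n / fact k * ((real k * x) ^ j / fact j * fps_nth (H ^ j) (n - k)))"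
    by (simp add: fps_compose_nth sum_distrib_left)
  \<comment> \<open>Here \<open>n! / k!\<close> splits as the binomial coefficient times
    \<open>(n - k)!\<close>; the latter, together with \<open>1 / j!\<close>, is absorbed by the
    Stirling number.\<close>
  also have "\<dots> = (\<Sum>j = 0..n - k.
      real (n choose k) * real k ^ j * x ^ j * het_stirling M Y l (n - k) j)"
    using \<open>k \<le> n\<close>
    by (intro sum.cong refl) (simp add: stirling binomial_fact power_mult_distrib)
  finally show ?thesis ..
qed

end
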